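(* Let $n \ge 1$, let $N$ be any positive integer (possibly depending arbitrarily on $n$), and let $0<\varepsilon<1$. There is no algorithm that uses $N$ independent samples from an unknown distribution $\mathcal{D}$ on $\mathbb{R}^n$ and, with probability at least $9/10$, outputs "un-truncated" when $\mathcal{D} = N(0,I_n)$ and outputs "truncated" whenever $\mathcal{D} \in \mathrm{Mix}(\mathcal{P}_{\mathrm{conv}})$ satisfies $d_{\mathrm{TV}}(N(0,I_n),\mathcal{D}) \ge \varepsilon$.
   Context: For a Lebesgue measurable $K \subseteq \mathbb{R}^n$ with Gaussian volume $\mathrm{vol}(K) := \Pr_{x\sim N(0,I_n)}[x\in K] > 0$, $N(0,I_n)|_K$ denotes the distribution with density $\mathrm{vol}(K)^{-1}\varphi_n(x)\mathbf{1}[x\in K]$, where $\varphi_n$ is the standard Gaussian density. $\mathcal{P}_{\mathrm{conv}}$ is the class of all distributions $N(0,I_n)|_K$ with $K \subseteq\mathbb{R}^n$ convex, and $\mathrm{Mix}(\mathcal{P}_{\mathrm{conv}})$ is the class of all convex combinations (mixtures) of distributions from $\mathcal{P}_{\mathrm{conv}}$. $d_{\mathrm{TV}}$ denotes total variation distance. *)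

theory Defs
  imports "HOL-Probability.Probability"
begin

definition gauss_density :: "real ^ 'n \<Rightarrow> real" where
  "gauss_density x = (2 * pi) powr (- real CARD('n) / 2) * exp (- (norm x)\<^sup>2 / 2)"

text \<open>All distributions live on the Lebesgue \<open>\<sigma>\<close>-algebra rather than the Borel one, because a
  convex set need not be Borel.\<close>

definition std_gaussian :: "(real ^ 'n) measure" where
  "std_gaussian = density lebesgue (\<lambda>x. ennreal (gauss_density x))"

definition gauss_vol :: "(real ^ 'n) set \<Rightarrow> real" where
  "gauss_vol K = measure std_gaussian K"

definition gauss_trunc :: "(real ^ 'n) set \<Rightarrow> (real ^ 'n) measure" where
  "gauss_trunc K =
     density lebesgue (\<lambda>x. ennreal (inverse (gauss_vol K) * gauss_density x * indicator K x))"

definition P_conv :: "(real ^ 'n) measure set" where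
  "P_conv = {gauss_trunc K | K. K \<in> sets lebesgue \<and> convex K \<and> 0 < gauss_vol K}"

definition Mix :: "(real ^ 'n) measure set \<Rightarrow> (real ^ 'n) measure set" where
  "Mix \<P> = {D. sets D = sets lebesgue \<and>
     (\<exists>(m::nat) (w :: nat \<Rightarrow> real) P.
        (\<forall>i<m. 0 \<le> w i \<and> P i \<in> \<P>) \<and> (\<Sum>i<m. w i) = 1 \<and>
        (\<forall>A\<in>sets lebesgue. emeasure D A = (\<Sum>i<m. ennreal (w i) * emeasure (P i) A)))}"

text \<open>Total variation distance; meant for probability measures on a common \<open>\<sigma>\<close>-algebra.\<close>

definition d_TV :: "'a measure \<Rightarrow> 'a measure \<Rightarrow> real" where
  "d_TV P Q = (SUP A\<in>sets P. \<bar>measure P A - measure Q A\<bar>)"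

datatype verdict = Untruncated | Truncated

text \<open>A randomized algorithm using \<open>N\<close> samples is a Markov kernel: it maps the sample sequence
  (measurably) to the distribution of its verdict. There is no restriction on computing resources,
  and deterministic algorithms are the kernels whose values are point masses.\<close>

definition sample_algorithms :: "nat \<Rightarrow> ((nat \<Rightarrow> real ^ 'n) \<Rightarrow> verdict measure) set" where
  "sample_algorithms N =
     measurable (\<Pi>\<^sub>M i\<in>{..<N}. lebesgue) (prob_algebra (count_space UNIV))"

definition output_prob ::
  "nat \<Rightarrow> ((nat \<Rightarrow> real ^ 'n) \<Rightarrow> verdict measure) \<Rightarrow> (real ^ 'n) measure \<Rightarrow> verdict \<Rightarrow> real" where
  "output_prob N \<A> D v = measure ((\<Pi>\<^sub>M i\<in>{..<N}. D) \<bind> \<A>) {v}"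

end

theory Submission
  imports Defs
begin

text \<open>Cut \<open>\<real>\<^sup>n\<close> into \<open>K\<close> parallel slabs of Gaussian volume \<open>1 / K\<close>, and for
  \<open>s : {..<m} \<rightarrow> {..<K}\<close> let \<open>D s\<close> be the uniform mixture of the Gaussians truncated to the slabs
  \<open>s 0, \<dots>, s (m - 1)\<close>. Its support has Gaussian volume at most \<open>m / K\<close>, so for large \<open>K\<close> every
  \<open>D s\<close> is far from Gaussian. If \<open>s\<close> is uniformly random and the \<open>N\<close> samples from \<open>D s\<close> come from
  distinct mixture components, then they are independent standard Gaussians; components collide with
  small probability once \<open>m\<close> is large compared with \<open>N\<^sup>2\<close>. Hence an algorithm that accepts the
  Gaussian also accepts some \<open>D s\<close> with probability more than \<open>1 / 10\<close>.\<close>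

section \<open>Densities of finite product measures\<close>

text \<open>A product measure is determined by its values on boxes, and there the integral of the
  product density factors by Fubini. It serves to write the law of \<open>N\<close> samples as a
  likelihood ratio against the base measure.\<close>

lemma PiM_density:
  assumes "prob_space M" "finite I" and g[measurable]: "g \<in> borel_measurable M"
    and "prob_space (density M g)"
  shows "(\<Pi>\<^sub>M i\<in>I. density M g) = density (\<Pi>\<^sub>M i\<in>I. M) (\<lambda>x. \<Prod>i\<in>I. g (x i))"
proof -
  interpret M: prob_space M by fact
  interpret D: prob_space "density M g" by fact
  interpret PM: product_sigma_finite "\<lambda>_. M" by standard
  interpret PD: product_sigma_finite "\<lambda>_. density M g" by standard
  show ?thesis
  proof (rule PD.PiM_eqI[symmetric])
    show "sets (density (\<Pi>\<^sub>M i\<in>I. M) (\<lambda>x. \<Prod>i\<in>I. g (x i))) = sets (\<Pi>\<^sub>M i\<in>I. density M g)"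
      by (simp cong: sets_PiM_cong)
    fix A assume "\<And>i. i \<in> I \<Longrightarrow> A i \<in> sets (density M g)"
    then have A[measurable]: "\<And>i. i \<in> I \<Longrightarrow> A i \<in> sets M" by simp
    \<comment> \<open>Off the box some indicator factor vanishes. Membership in the space supplies
      the extensionality that \<open>Pi\<^sub>E\<close> also demands.\<close>
    have ind: "(\<Prod>i\<in>I. g (x i)) * indicator (Pi\<^sub>E I A) x = (\<Prod>i\<in>I. g (x i) * indicator (A i) (x i))"
      if "x \<in> space (\<Pi>\<^sub>M i\<in>I. M)" for x
    proof -
      have "indicator (Pi\<^sub>E I A) x = (\<Prod>i\<in>I. indicator (A i) (x i) :: ennreal)"
        using that \<open>finite I\<close> by (force simp: indicator_def space_PiM PiE_iff prod_zero_iff)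
      then show ?thesis by (simp add: prod.distrib)
    qed
    have "emeasure (density (\<Pi>\<^sub>M i\<in>I. M) (\<lambda>x. \<Prod>i\<in>I. g (x i))) (Pi\<^sub>E I A)
      = (\<integral>\<^sup>+x. (\<Prod>i\<in>I. g (x i)) * indicator (Pi\<^sub>E I A) x \<partial>(\<Pi>\<^sub>M i\<in>I. M))"
      using \<open>finite I\<close> by (intro emeasure_density) (auto intro!: sets_PiM_I_finite)
    also have "\<dots> = (\<integral>\<^sup>+x. (\<Prod>i\<in>I. g (x i) * indicator (A i) (x i)) \<partial>(\<Pi>\<^sub>M i\<in>I. M))"
      using ind by (rule nn_integral_cong)
    also have "\<dots> = (\<Prod>i\<in>I. \<integral>\<^sup>+x. g x * indicator (A i) x \<partial>M)"
      using \<open>finite I\<close> by (intro PM.product_nn_integral_prod) auto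
    also have "\<dots> = (\<Prod>i\<in>I. emeasure (density M g) (A i))"
      by (intro prod.cong refl emeasure_density[symmetric]) auto
    finally show "emeasure (density (\<Pi>\<^sub>M i\<in>I. M) (\<lambda>x. \<Prod>i\<in>I. g (x i))) (Pi\<^sub>E I A)
      = (\<Prod>i\<in>I. emeasure (density M g) (A i))" .
  qed fact
qed

section \<open>Counting component assignments without collisions\<close>

text \<open>Here \<open>\<iota> l\<close> is the component that sample \<open>l\<close> comes from.
  Injectivity makes the \<open>N\<close> constraints fix \<open>s\<close> at \<open>N\<close>
  distinct places, one value each, and the other \<open>m - N\<close> places are free.\<close>

lemma sum_PiE_prod_of_bool_inj:
  fixes y :: "nat \<Rightarrow> nat"
  assumes \<iota>: "\<iota> \<in> {..<N} \<rightarrow>\<^sub>E {..<m}" "inj_on \<iota> {..<N}" and y: "\<And>l. l < N \<Longrightarrow> y l < K"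
  shows "(\<Sum>s\<in>{..<m} \<rightarrow>\<^sub>E {..<K}. \<Prod>l<N. of_bool (s (\<iota> l) = y l) :: real) = real K ^ (m - N)"
proof -
  \<comment> \<open>The constraint on place \<open>i\<close>, or the constant 1 if no sample uses
    \<open>i\<close>. This turns a product over samples into one over places, so that the sum over
    \<open>s\<close> factors.\<close>
  define h :: "nat \<Rightarrow> nat \<Rightarrow> real" where
    "h i c = (if i \<in> \<iota> ` {..<N} then of_bool (c = y (inv_into {..<N} \<iota> i)) else 1)" for i c
  have sub: "\<iota> ` {..<N} \<subseteq> {..<m}" using \<iota>(1) by auto
  have "(\<Prod>l<N. of_bool (s (\<iota> l) = y l)) = (\<Prod>i<m. h i (s i))" for s
  proof -
    have "(\<Prod>i<m. h i (s i)) = (\<Prod>i\<in>\<iota> ` {..<N}. h i (s i))"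
      using sub by (intro prod.mono_neutral_right) (auto simp: h_def)
    also have "\<dots> = (\<Prod>l<N. h (\<iota> l) (s (\<iota> l)))"
      using \<iota>(2) by (simp add: prod.reindex)
    also have "\<dots> = (\<Prod>l<N. of_bool (s (\<iota> l) = y l))"
      using \<iota>(2) by (intro prod.cong) (auto simp: h_def inv_into_f_f)
    finally show ?thesis ..
  qed
  then have "(\<Sum>s\<in>{..<m} \<rightarrow>\<^sub>E {..<K}. \<Prod>l<N. of_bool (s (\<iota> l) = y l) :: real) = (\<Prod>i<m. \<Sum>c<K. h i c)"
    by (simp add: prod_sum_PiE)
  also have "\<dots> = (\<Prod>i<m. if i \<in> \<iota> ` {..<N} then 1 else real K)"
  proof (rule prod.cong[OF refl])
    fix i
    show "(\<Sum>c<K. h i c) = (if i \<in> \<iota> ` {..<N} then 1 else real K)"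
    proof (cases "i \<in> \<iota> ` {..<N}")
      case True
      then have "y (inv_into {..<N} \<iota> i) < K"
        using y inv_into_into[OF True] by simp
      then have "(\<Sum>c<K. of_bool (c = y (inv_into {..<N} \<iota> i)) :: real) = 1"
        by (simp add: of_bool_def sum.delta)
      with True show ?thesis by (simp add: h_def)
    qed (simp add: h_def)
  qed
  also have "\<dots> = (\<Prod>i\<in>{..<m} - \<iota> ` {..<N}. real K)"
    by (intro prod.mono_neutral_cong_right) auto
  also have "\<dots> = real K ^ (m - N)"
    using sub \<iota>(2) by (simp add: card_Diff_subset card_image)
  finally show ?thesis .
qed

text \<open>Each cardinality is a sum over places, so expanding the product sums over all maps
  \<open>\<iota>\<close> from samples to places. Keeping only the injective ones loses little.
  Divided by \<open>K ^ m\<close>, this bounds from below the likelihood ratio at \<open>y\<close>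
  averaged over \<open>s\<close>, uniformly in \<open>y\<close>.\<close>

lemma sum_PiE_prod_card_ge:
  fixes y :: "nat \<Rightarrow> nat"
  assumes "0 < m" "N \<le> m" and y: "\<And>l. l < N \<Longrightarrow> y l < K"
  shows "real K ^ m * (1 - N / m) ^ N
    \<le> (\<Sum>s\<in>{..<m} \<rightarrow>\<^sub>E {..<K}. \<Prod>l<N. real K / m * card {i. i < m \<and> s i = y l})"
proof -
  let ?S = "{..<m} \<rightarrow>\<^sub>E {..<K}" and ?T = "{..<N} \<rightarrow>\<^sub>E {..<m}"
  let ?J = "{\<iota> \<in> ?T. inj_on \<iota> {..<N}}"
  have fin: "finite ?T" "finite ?S" by (auto intro: finite_PiE)
  have "real (card ?J) = (\<Prod>l<N. real m - real l)"
    using card_inj_on_subset_funcset[of "{..<N}" "{..<m}" "{..<N}"] \<open>N \<le> m\<close>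
    by (simp add: lessThan_atLeast0 of_nat_diff)
  \<comment> \<open>The number of injections is a falling factorial, each of whose factors is at
    least \<open>m - N\<close>.\<close>
  moreover have "(\<Prod>l<N. real m - real N) \<le> (\<Prod>l<N. real m - real l)"
    using \<open>N \<le> m\<close> by (intro prod_mono) auto
  ultimately have cardJ: "(real m - real N) ^ N \<le> card ?J" by simp
  have card_eq: "real (card {i. i < m \<and> s i = c}) = (\<Sum>i<m. of_bool (s i = c))" for s :: "nat \<Rightarrow> nat" and c
    by (simp add: of_bool_def sum.If_cases lessThan_def Int_def)
  have "real K ^ m * (1 - N / m) ^ N = (real K / m) ^ N * (real K ^ (m - N) * (real m - real N) ^ N)"
  proof -
    have "1 - N / m = (real m - real N) / m" using \<open>0 < m\<close> by (simp add: field_simps)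
    then show ?thesis using \<open>N \<le> m\<close>
      by (simp add: power_divide mult.assoc[symmetric] power_add[symmetric])
  qed
  also have "\<dots> \<le> (real K / m) ^ N * (real K ^ (m - N) * card ?J)"
    using cardJ by (intro mult_left_mono) auto
  also have "\<dots> = (real K / m) ^ N * (\<Sum>\<iota>\<in>?J. \<Sum>s\<in>?S. \<Prod>l<N. of_bool (s (\<iota> l) = y l))"
    using y by (simp add: sum_PiE_prod_of_bool_inj)
  \<comment> \<open>The maps with collisions contribute nonnegative terms and may be added
    back.\<close>
  also have "\<dots> \<le> (real K / m) ^ N * (\<Sum>\<iota>\<in>?T. \<Sum>s\<in>?S. \<Prod>l<N. of_bool (s (\<iota> l) = y l))"
    using fin by (intro mult_left_mono sum_mono2) (auto intro!: sum_nonneg prod_nonneg)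
  also have "\<dots> = (\<Sum>s\<in>?S. (real K / m) ^ N * (\<Sum>\<iota>\<in>?T. \<Prod>l<N. of_bool (s (\<iota> l) = y l)))"
    by (subst sum.swap) (simp add: sum_distrib_left)
  also have "\<dots> = (\<Sum>s\<in>?S. \<Prod>l<N. real K / m * card {i. i < m \<and> s i = y l})"
    by (simp only: card_eq prod.distrib prod_constant card_lessThan prod_sum_PiE finite_lessThan)
  finally show ?thesis .
qed

section \<open>The probability integral transform\<close>

text \<open>Without atoms the distribution function is continuous, so it attains every value
  strictly between 0 and 1. Its sublevel sets can then be compared with half-lines
  \<open>{..b}\<close>.\<close>

lemma (in real_distribution) measure_cdf_le:
  assumes atomless: "\<And>t. measure M {t} = 0" and u: "0 \<le> u" "u \<le> 1"
  shows "measure M {t. cdf M t \<le> u} = u"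
proof -
  have cont: "continuous_on UNIV (cdf M)"
    using atomless isCont_cdf by (simp add: continuous_on_eq_continuous_at)
  then have [measurable]: "cdf M \<in> borel_measurable borel"
    by (rule borel_measurable_continuous_onI)
  have ivt: "\<exists>t. cdf M t = v" if v: "0 < v" "v < 1" for v
  proof -
    obtain a where a: "cdf M a < v"
      using order_tendstoD(2)[OF cdf_lim_at_bot v(1)]
      by (metis eventually_at_bot_linorder order_refl)
    obtain b where b: "v < cdf M b"
      using order_tendstoD(1)[OF cdf_lim_at_top_prob v(2)]
      by (metis eventually_at_top_linorder order_refl)
    have "a \<le> b" using a b cdf_nondecreasing[of b a] by linarith
    then show ?thesis
      using IVT'[of "cdf M" a v b] a b continuous_on_subset[OF cont] by auto
  qed
  \<comment> \<open>The strict inequality is what puts the set inside \<open>{..b}\<close>: the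
    distribution function may stay at \<open>v\<close> beyond \<open>b\<close>.\<close>
  have less: "measure M {t. cdf M t < v} \<le> v" if v: "0 < v" "v < 1" for v
  proof -
    obtain b where b: "cdf M b = v" using ivt v by blast
    have "measure M {t. cdf M t < v} \<le> measure M {..b}"
    proof (rule finite_measure_mono)
      show "{t. cdf M t < v} \<subseteq> {..b}"
      proof
        fix t assume "t \<in> {t. cdf M t < v}"
        then show "t \<in> {..b}" using b cdf_nondecreasing[of b t] by force
      qed
    qed auto
    then show ?thesis using b by (simp add: cdf_def)
  qed
  have "measure M {t. cdf M t \<le> u} \<le> v" if v: "u < v" "v < 1" for v
  proof -
    have "measure M {t. cdf M t \<le> u} \<le> measure M {t. cdf M t < v}"
      using v by (intro finite_measure_mono) auto
    also have "\<dots> \<le> v" using less v u by simp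
    finally show ?thesis .
  qed
  \<comment> \<open>Let \<open>v\<close> decrease to \<open>u\<close>. For \<open>u = 1\<close>
    there is no such \<open>v\<close>, but a probability is at most 1.\<close>
  then have upper: "measure M {t. cdf M t \<le> u} \<le> u"
    using u by (cases "u = 1") (auto intro: dense_ge_bounded[of u 1])
  have lower: "u \<le> measure M {t. cdf M t \<le> u}"
  proof -
    consider "u = 0" | "0 < u" "u < 1" | "u = 1" using u by linarith
    then show ?thesis
    proof cases
      case 2
      then obtain a where a: "cdf M a = u" using ivt by blast
      have "measure M {..a} \<le> measure M {t. cdf M t \<le> u}"
        using cdf_nondecreasing a by (intro finite_measure_mono) auto
      then show ?thesis using a by (simp add: cdf_def)
    next
      case 3
      then have "{t. cdf M t \<le> u} = space M" using cdf_bounded_prob by auto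
      then show ?thesis using 3 prob_space by simp
    qed simp
  qed
  from upper lower show ?thesis by simp
qed

section \<open>Equipartitions and mixtures of their cells\<close>

text \<open>Indistinguishability and distance from \<open>M\<close> depend only on the cells having
  equal mass. Geometry enters later, when the cells are chosen convex.\<close>

locale equipartition = prob_space M for M :: "'a measure" +
  fixes cell :: "'a \<Rightarrow> nat" and K :: nat
  assumes measurable_cell [measurable]: "cell \<in> measurable M (count_space UNIV)"
    and cell_less: "x \<in> space M \<Longrightarrow> cell x < K"
    and prob_cell: "c < K \<Longrightarrow> prob {x \<in> space M. cell x = c} = 1 / K"
begin

text \<open>Conditioning on one cell has density \<open>K\<close> on that cell. This is the average
  of \<open>m\<close> such densities, so a cell repeated by \<open>s\<close> counts with
  multiplicity.\<close>

definition block_density :: "nat \<Rightarrow> (nat \<Rightarrow> nat) \<Rightarrow> 'a \<Rightarrow> real" where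
  "block_density m s x = real K / m * card {i. i < m \<and> s i = cell x}"

definition block_mixture :: "nat \<Rightarrow> (nat \<Rightarrow> nat) \<Rightarrow> 'a measure" where
  "block_mixture m s = density M (\<lambda>x. ennreal (block_density m s x))"

lemma sets_block_mixture [simp, measurable_cong]: "sets (block_mixture m s) = sets M"
  and space_block_mixture [simp]: "space (block_mixture m s) = space M"
  by (simp_all add: block_mixture_def)

lemma measurable_block_density [measurable]: "block_density m s \<in> borel_measurable M"
  unfolding block_density_def[abs_def] by measurable

lemma block_density_nonneg: "0 \<le> block_density m s x"
  by (simp add: block_density_def)

lemma block_density_eq_sum:
  assumes "x \<in> space M"
  shows "block_density m s x =
    (\<Sum>i<m. 1 / m * (real K * indicat_real {x \<in> space M. cell x = s i} x))"
proof -
  have "real (card {i. i < m \<and> s i = cell x}) = (\<Sum>i<m. of_bool (s i = cell x))"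
    by (simp add: of_bool_def sum.If_cases lessThan_def Int_def)
  also have "\<dots> = (\<Sum>i<m. indicator {x \<in> space M. cell x = s i} x)"
    using assms by (intro sum.cong) (auto simp: indicator_def)
  finally show ?thesis
    by (simp add: block_density_def sum_distrib_left mult.assoc)
qed

text \<open>For a cell of index below \<open>K\<close>, the factor multiplied by
  \<open>1 / m\<close> is the conditional probability of \<open>A\<close> given that cell. This form
  is the link to \<open>Mix\<close>.\<close>

lemma emeasure_block_mixture:
  assumes [measurable]: "A \<in> sets M"
  shows "emeasure (block_mixture m s) A =
    (\<Sum>i<m. ennreal (1 / m) * (of_nat K * emeasure M (A \<inter> {x \<in> space M. cell x = s i})))"
proof -
  have "emeasure (block_mixture m s) A = (\<integral>\<^sup>+x. ennreal (block_density m s x) * indicator A x \<partial>M)"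
    unfolding block_mixture_def by (intro emeasure_density) auto
  also have "\<dots> = (\<integral>\<^sup>+x. (\<Sum>i<m. ennreal (1 / m) *
      (of_nat K * indicator (A \<inter> {x \<in> space M. cell x = s i}) x)) \<partial>M)"
  proof (rule nn_integral_cong)
    fix x assume x: "x \<in> space M"
    have "ennreal (block_density m s x) = (\<Sum>i<m. ennreal (1 / m) *
      (of_nat K * indicator {x \<in> space M. cell x = s i} x))"
      unfolding block_density_eq_sum[OF x]
      by (subst sum_ennreal[symmetric], simp, rule sum.cong[OF refl])
        (simp add: ennreal_mult ennreal_of_nat_eq_real_of_nat ennreal_indicator del: times_divide_eq_left times_divide_eq_right)
    then show "ennreal (block_density m s x) * indicator A x = (\<Sum>i<m. ennreal (1 / m) *
      (of_nat K * indicator (A \<inter> {x \<in> space M. cell x = s i}) x))"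
      by (simp add: sum_distrib_right indicator_inter_arith mult.assoc mult.commute[of "indicator A x"])
  qed
  also have "\<dots> = (\<Sum>i<m. ennreal (1 / m) *
      (of_nat K * emeasure M (A \<inter> {x \<in> space M. cell x = s i})))"
    by (subst nn_integral_sum) (auto simp: nn_integral_cmult)
  finally show ?thesis .
qed

lemma emeasure_cell: "c < K \<Longrightarrow> of_nat K * emeasure M {x \<in> space M. cell x = c} = 1"
  by (simp add: emeasure_eq_measure prob_cell ennreal_of_nat_eq_real_of_nat ennreal_mult[symmetric])

lemma prob_space_block_mixture:
  assumes "0 < m" "s \<in> {..<m} \<rightarrow> {..<K}"
  shows "prob_space (block_mixture m s)"
proof
  have "emeasure (block_mixture m s) (space M) = (\<Sum>i<m. ennreal (1 / m) * 1)"
    unfolding emeasure_block_mixture[OF sets.top]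
  proof (intro sum.cong refl)
    fix i assume "i \<in> {..<m}"
    then have "s i < K" using assms(2) by auto
    moreover have "space M \<inter> {x \<in> space M. cell x = s i} = {x \<in> space M. cell x = s i}" by auto
    ultimately show "ennreal (1 / m) * (of_nat K * emeasure M (space M \<inter> {x \<in> space M. cell x = s i}))
      = ennreal (1 / m) * 1"
      using emeasure_cell by simp
  qed
  also have "\<dots> = 1"
    using assms(1)
    by (simp add: ennreal_of_nat_eq_real_of_nat ennreal_mult[symmetric] del: ennreal_1 flip: ennreal_1)
  finally show "emeasure (block_mixture m s) (space (block_mixture m s)) = 1" by simp
qed

text \<open>The counting bound holds at every sample point, so it can be multiplied by
  \<open>f\<close> and integrated. This one-sided comparison of the base product with the average
  over \<open>s\<close> is all that the contradiction requires.\<close>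

lemma nn_integral_PiM_block_mixture_average_ge:
  assumes "0 < m" "N \<le> m" and f[measurable]: "f \<in> borel_measurable (\<Pi>\<^sub>M i\<in>{..<N}. M)"
  shows "ennreal (real K ^ m * (1 - N / m) ^ N) * (\<integral>\<^sup>+x. f x \<partial>(\<Pi>\<^sub>M i\<in>{..<N}. M))
    \<le> (\<Sum>s\<in>{..<m} \<rightarrow>\<^sub>E {..<K}. \<integral>\<^sup>+x. f x \<partial>(\<Pi>\<^sub>M i\<in>{..<N}. block_mixture m s))"
proof -
  let ?P = "\<Pi>\<^sub>M i\<in>{..<N}. M" and ?S = "{..<m} \<rightarrow>\<^sub>E {..<K}"
  have int: "(\<integral>\<^sup>+x. f x \<partial>(\<Pi>\<^sub>M i\<in>{..<N}. block_mixture m s)) =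
      (\<integral>\<^sup>+x. (\<Prod>l<N. ennreal (block_density m s (x l))) * f x \<partial>?P)" if "s \<in> ?S" for s
  proof -
    have "prob_space (block_mixture m s)"
      using that \<open>0 < m\<close> by (intro prob_space_block_mixture) auto
    then have "(\<Pi>\<^sub>M i\<in>{..<N}. block_mixture m s)
        = density ?P (\<lambda>x. \<Prod>l<N. ennreal (block_density m s (x l)))"
      unfolding block_mixture_def by (intro PiM_density prob_space_axioms) auto
    then show ?thesis by (simp add: nn_integral_density)
  qed
  have "ennreal (real K ^ m * (1 - N / m) ^ N) * (\<integral>\<^sup>+x. f x \<partial>?P)
      = (\<integral>\<^sup>+x. ennreal (real K ^ m * (1 - N / m) ^ N) * f x \<partial>?P)"
    by (simp add: nn_integral_cmult)
  also have "\<dots> \<le> (\<integral>\<^sup>+x. (\<Sum>s\<in>?S. (\<Prod>l<N. ennreal (block_density m s (x l))) * f x) \<partial>?P)"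
  proof (rule nn_integral_mono)
    fix x assume x: "x \<in> space ?P"
    then have "cell (x l) < K" if "l < N" for l
      using that by (intro cell_less) (auto simp: space_PiM)
    then have "real K ^ m * (1 - N / m) ^ N \<le> (\<Sum>s\<in>?S. \<Prod>l<N. block_density m s (x l))"
      unfolding block_density_def using assms(1,2) by (intro sum_PiE_prod_card_ge) auto
    then have "ennreal (real K ^ m * (1 - N / m) ^ N)
        \<le> (\<Sum>s\<in>?S. \<Prod>l<N. ennreal (block_density m s (x l)))"
      by (simp add: prod_ennreal sum_ennreal block_density_nonneg prod_nonneg ennreal_leI)
    then show "ennreal (real K ^ m * (1 - N / m) ^ N) * f x
        \<le> (\<Sum>s\<in>?S. (\<Prod>l<N. ennreal (block_density m s (x l))) * f x)"
      by (simp add: sum_distrib_right[symmetric] mult_right_mono)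
  qed
  also have "\<dots> = (\<Sum>s\<in>?S. \<integral>\<^sup>+x. (\<Prod>l<N. ennreal (block_density m s (x l))) * f x \<partial>?P)"
    by (intro nn_integral_sum) measurable
  also have "\<dots> = (\<Sum>s\<in>?S. \<integral>\<^sup>+x. f x \<partial>(\<Pi>\<^sub>M i\<in>{..<N}. block_mixture m s))"
    by (simp add: int)
  finally show ?thesis .
qed

text \<open>The distinguishing event \<open>?A\<close> is the complement of the chosen cells. The
  mixture gives it mass 0, while by the union bound \<open>M\<close> gives it at least
  \<open>1 - m / K\<close>.\<close>

lemma d_TV_block_mixture_ge:
  assumes "0 < m" and s: "s \<in> {..<m} \<rightarrow> {..<K}"
  shows "1 - real m / K \<le> d_TV M (block_mixture m s)"
proof -
  interpret D: prob_space "block_mixture m s"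
    using assms by (rule prob_space_block_mixture)
  let ?B = "\<Union>i<m. {x \<in> space M. cell x = s i}"
  let ?A = "space M - ?B"
  have "prob ?B \<le> (\<Sum>i<m. prob {x \<in> space M. cell x = s i})"
    by (intro finite_measure_subadditive_finite) auto
  also have "\<dots> = real m / K"
    using s prob_cell by (simp add: Pi_iff)
  finally have 1: "1 - real m / K \<le> prob ?A"
    by (subst prob_compl) auto
  have "?A \<inter> {x \<in> space M. cell x = s i} = {}" if "i < m" for i
    using that by auto
  then have "emeasure (block_mixture m s) ?A = 0"
    by (subst emeasure_block_mixture) auto
  then have 2: "measure (block_mixture m s) ?A = 0"
    by (simp add: measure_def)
  have bdd: "bdd_above ((\<lambda>A. \<bar>measure M A - measure (block_mixture m s) A\<bar>) ` sets M)"
  proof (rule bdd_aboveI2)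
    fix A
    show "\<bar>measure M A - measure (block_mixture m s) A\<bar> \<le> 1"
      using prob_le_1[of A] D.prob_le_1[of A] measure_nonneg[of M A] measure_nonneg[of "block_mixture m s" A]
      unfolding abs_le_iff by linarith
  qed
  have "prob ?A \<le> \<bar>measure M ?A - measure (block_mixture m s) ?A\<bar>"
    by (simp add: 2)
  also have "\<dots> \<le> d_TV M (block_mixture m s)"
    unfolding d_TV_def by (rule cSUP_upper[OF _ bdd]) auto
  finally show ?thesis using 1 by simp
qed

end

section \<open>The standard Gaussian and its division into convex slabs\<close>

lemma gauss_density_nonneg [simp]: "0 \<le> gauss_density x"
  by (simp add: gauss_density_def)

lemma borel_measurable_gauss_density [measurable]:
  "gauss_density \<in> borel_measurable borel"
  unfolding gauss_density_def[abs_def] by measurable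

text \<open>Splitting the squared norm over coordinates reduces normalization to the one-dimensional
  normal density.\<close>

lemma gauss_density_eq_prod:
  fixes x :: "real ^ 'n"
  shows "gauss_density x = (\<Prod>b\<in>Basis. std_normal_density (x \<bullet> b))"
proof -
  have norm: "(norm x)\<^sup>2 = (\<Sum>b\<in>Basis. (x \<bullet> b)\<^sup>2)"
    by (subst power2_norm_eq_inner, subst euclidean_inner) (simp add: power2_eq_square)
  have "(2 * pi) powr (- real CARD('n) / 2) = ((2 * pi) powr (- (1 / 2))) powr real CARD('n)"
    by (simp add: powr_powr)
  also have "(2 * pi) powr (- (1 / 2)) = 1 / sqrt (2 * pi)"
    by (simp only: powr_minus_divide powr_half_sqrt mult_nonneg_nonneg pi_ge_zero zero_le_numeral)
  also have "(1 / sqrt (2 * pi)) powr real CARD('n) = (1 / sqrt (2 * pi)) ^ CARD('n)"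
    by (rule powr_realpow) simp
  also have "\<dots> = (\<Prod>b\<in>(Basis :: (real ^ 'n) set). 1 / sqrt (2 * pi))"
    by simp
  finally have const: "(2 * pi) powr (- real CARD('n) / 2) = \<dots>" .
  have "exp (- (norm x)\<^sup>2 / 2) = (\<Prod>b\<in>Basis. exp (- (x \<bullet> b)\<^sup>2 / 2))"
    unfolding norm by (subst exp_sum[symmetric]) (simp_all add: sum_negf sum_divide_distrib)
  then show ?thesis
    unfolding gauss_density_def const std_normal_density_def by (simp only: prod.distrib)
qed

lemma prob_space_std_gaussian: "prob_space (std_gaussian :: (real ^ 'n) measure)"
proof
  \<comment> \<open>The density is Borel, so the integral over the completion can be computed over
    \<open>lborel\<close>, where the product formula is available.\<close>
  have "emeasure std_gaussian (space std_gaussian :: (real ^ 'n) set)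
      = (\<integral>\<^sup>+x. ennreal (gauss_density (x :: real ^ 'n)) \<partial>lborel)"
    by (simp add: std_gaussian_def emeasure_density nn_integral_completion measurable_completion)
  also have "\<dots> = (\<integral>\<^sup>+x. (\<Prod>b\<in>Basis. ennreal (std_normal_density ((x :: real ^ 'n) \<bullet> b))) \<partial>lborel)"
    by (simp add: gauss_density_eq_prod prod_ennreal)
  also have "\<dots> = (\<Prod>b\<in>(Basis :: (real^'n) set). \<integral>\<^sup>+x. ennreal (std_normal_density x) \<partial>lborel)"
    by (rule nn_integral_lborel_prod) auto
  also have "(\<integral>\<^sup>+x. ennreal (std_normal_density x) \<partial>lborel) = 1"
    by (subst nn_integral_eq_integral) auto
  finally show "emeasure std_gaussian (space std_gaussian :: (real ^ 'n) set) = 1" by simp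
qed

lemma sets_std_gaussian [simp, measurable_cong]: "sets std_gaussian = sets lebesgue"
  and space_std_gaussian [simp]: "space std_gaussian = UNIV"
  by (simp_all add: std_gaussian_def)

lemma emeasure_gauss_trunc:
  fixes C :: "(real ^ 'n) set"
  assumes [measurable]: "C \<in> sets lebesgue" "A \<in> sets lebesgue"
  shows "emeasure (gauss_trunc C) A = ennreal (inverse (gauss_vol C)) * emeasure std_gaussian (A \<inter> C)"
proof -
  have [measurable]: "(\<lambda>x. gauss_density x) \<in> borel_measurable (lebesgue :: (real ^ 'n) measure)"
    by (simp add: measurable_completion)
  have nn: "0 \<le> inverse (gauss_vol C)" by (simp add: gauss_vol_def)
  have "emeasure (gauss_trunc C) A
    = (\<integral>\<^sup>+x. ennreal (inverse (gauss_vol C) * gauss_density x * indicator C x) * indicator A x \<partial>lebesgue)"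
    unfolding gauss_trunc_def by (intro emeasure_density) auto
  also have "\<dots> = (\<integral>\<^sup>+x. ennreal (inverse (gauss_vol C)) * (ennreal (gauss_density x) * indicator (A \<inter> C) x) \<partial>lebesgue)"
    using nn by (intro nn_integral_cong) (auto simp: indicator_def ennreal_mult)
  also have "\<dots> = ennreal (inverse (gauss_vol C)) * emeasure std_gaussian (A \<inter> C)"
    unfolding std_gaussian_def by (subst emeasure_density) (auto intro!: nn_integral_cmult)
  finally show ?thesis .
qed

text \<open>A hyperplane is Lebesgue-null. This makes the law of a single coordinate free of
  atoms.\<close>

lemma emeasure_std_gaussian_hyperplane:
  "emeasure std_gaussian {x :: real ^ 'n. x $ k = t} = 0"
proof -
  have [measurable]: "(\<lambda>x. gauss_density x) \<in> borel_measurable (lebesgue :: (real ^ 'n) measure)"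
    by (simp add: measurable_completion)
  have null: "{x :: real ^ 'n. x $ k = t} \<in> null_sets lebesgue"
    using negligible_standard_hyperplane[of "axis k 1 :: real ^ 'n" t]
    by (simp add: axis_in_Basis_iff inner_axis flip: negligible_iff_null_sets)
  note [measurable] = null_setsD2[OF null]
  have "AE x in lebesgue. x \<notin> {x :: real ^ 'n. x $ k = t}"
    using null by (rule AE_not_in)
  then have "(\<integral>\<^sup>+x. ennreal (gauss_density x) * indicator {x :: real ^ 'n. x $ k = t} x \<partial>lebesgue) = 0"
    by (subst nn_integral_0_iff_AE) auto
  then show ?thesis
    unfolding std_gaussian_def by (subst emeasure_density) auto
qed

text \<open>The cells are slabs: coordinate \<open>k\<close> has a continuous distribution function \<open>F\<close>, so
  \<open>F (x $ k)\<close> is uniformly distributed on \<open>[0, 1]\<close>. The cell with index \<open>c\<close> consists of the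
  \<open>x\<close> with \<open>c / K < F (x $ k) \<le> (c + 1) / K\<close>, except that cell \<open>0\<close> also contains the
  \<open>x\<close> with \<open>F (x $ k) = 0\<close>, because of the truncated subtraction.\<close>

lemma exists_convex_equipartition:
  assumes "0 < K"
  obtains cell :: "real ^ 'n \<Rightarrow> nat"
  where "equipartition std_gaussian cell K" "\<And>c. convex {x. cell x = c}"
proof -
  interpret G: prob_space "std_gaussian :: (real ^ 'n) measure"
    by (rule prob_space_std_gaussian)
  \<comment> \<open>Any coordinate will do; index types are nonempty.\<close>
  obtain k :: 'n where True by simp
  let ?X = "\<lambda>x :: real ^ 'n. x $ k"
  have X[measurable]: "?X \<in> borel_measurable std_gaussian"
    by (simp add: std_gaussian_def measurable_completion)
  define \<nu> where "\<nu> = distr std_gaussian borel ?X"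
  interpret \<nu>: real_distribution \<nu>
    unfolding \<nu>_def using X by (rule G.real_distribution_distr)
  have atomless: "measure \<nu> {t} = 0" for t
  proof -
    have "measure \<nu> {t} = G.prob {x. x $ k = t}"
      unfolding \<nu>_def by (simp add: measure_distr vimage_def)
    then show ?thesis
      using emeasure_std_gaussian_hyperplane[of k t] by (simp add: measure_def)
  qed
  have [measurable]: "cdf \<nu> \<in> borel_measurable borel"
    using atomless \<nu>.isCont_cdf
    by (intro borel_measurable_continuous_onI) (simp add: continuous_on_eq_continuous_at)
  have uniform: "G.prob {x. cdf \<nu> (x $ k) \<le> u} = u" if "0 \<le> u" "u \<le> 1" for u
  proof -
    have "G.prob {x. cdf \<nu> (x $ k) \<le> u} = measure \<nu> {t. cdf \<nu> t \<le> u}"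
      unfolding \<nu>_def by (subst measure_distr) (auto simp: vimage_def simp flip: \<nu>_def)
    then show ?thesis using \<nu>.measure_cdf_le[OF atomless that] by simp
  qed
  define J where "J t = nat \<lceil>K * cdf \<nu> t\<rceil> - 1" for t
  \<comment> \<open>Also at \<open>x = 0\<close>, truncated subtraction satisfies
    \<open>x - 1 \<le> c\<close> iff \<open>x \<le> c + 1\<close>. So the union of cells
    \<open>0, \<dots>, c\<close> is a sublevel set of the distribution function.\<close>
  have J_le: "J t \<le> c \<longleftrightarrow> cdf \<nu> t \<le> (c + 1) / K" for t c
    using \<open>0 < K\<close> \<nu>.cdf_nonneg[of t]
    unfolding J_def by (simp add: le_diff_conv nat_le_iff ceiling_le_iff field_simps)
  have "mono J"
    unfolding J_def using \<nu>.cdf_nondecreasing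
    by (intro monoI diff_le_mono nat_mono ceiling_mono mult_left_mono) auto
  have [measurable]: "J \<in> measurable borel (count_space UNIV)"
    unfolding J_def by measurable
  have "equipartition std_gaussian (\<lambda>x. J (x $ k)) K"
  proof
    show "(\<lambda>x :: real ^ 'n. J (x $ k)) \<in> measurable std_gaussian (count_space UNIV)"
      by measurable
    show "J (x $ k) < K" for x :: "real ^ 'n"
    proof -
      have "J (x $ k) \<le> K - 1"
        unfolding J_le using \<open>0 < K\<close> \<nu>.cdf_bounded_prob by (simp add: of_nat_diff)
      then show ?thesis using \<open>0 < K\<close> by simp
    qed
    fix c assume "c < K"
    have le: "G.prob {x. J (x $ k) \<le> c} = (real c + 1) / K"
      unfolding J_le using \<open>c < K\<close> by (intro uniform) auto
    have less: "G.prob {x. J (x $ k) < c} = c / K"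
    proof (cases c)
      case (Suc d)
      have "G.prob {x. J (x $ k) < c} = G.prob {x. J (x $ k) \<le> d}"
        unfolding Suc less_Suc_eq_le ..
      also have "\<dots> = (real d + 1) / K"
        unfolding J_le using \<open>c < K\<close> Suc by (intro uniform) auto
      finally show ?thesis by (simp add: Suc add.commute)
    qed simp
    have "{x \<in> space std_gaussian. J (x $ k) = c} = {x. J (x $ k) \<le> c} - {x. J (x $ k) < c}"
      by auto
    also have "G.prob \<dots> = G.prob {x. J (x $ k) \<le> c} - G.prob {x. J (x $ k) < c}"
    proof (rule G.finite_measure_Diff)
      have "{x \<in> space std_gaussian. J (x $ k) \<le> c} \<in> G.events" by measurable
      then show "{x. J (x $ k) \<le> c} \<in> G.events" by simp
      have "{x \<in> space std_gaussian. J (x $ k) < c} \<in> G.events" by measurable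
      then show "{x. J (x $ k) < c} \<in> G.events" by simp
    qed auto
    also have "\<dots> = 1 / K"
      unfolding le less by (simp add: diff_divide_distrib[symmetric])
    finally show "G.prob {x \<in> space std_gaussian. J (x $ k) = c} = 1 / K" .
  qed
  moreover have "convex {x :: real ^ 'n. J (x $ k) = c}" for c
  proof -
    \<comment> \<open>A fibre of a monotone function is an interval, and its preimage under the
      linear coordinate map is convex.\<close>
    have "is_interval {t. J t = c}"
      unfolding is_interval_1
    proof (intro ballI allI impI)
      fix a b t assume "a \<in> {t. J t = c}" "b \<in> {t. J t = c}" "a \<le> t \<and> t \<le> b"
      then show "t \<in> {t. J t = c}"
        using monoD[OF \<open>mono J\<close>, of a t] monoD[OF \<open>mono J\<close>, of t b] by auto
    qed
    then have "convex {t. J t = c}" by (rule is_interval_convex)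
    then have "convex (?X -` {t. J t = c})"
      by (intro convex_linear_vimage) (auto intro!: linearI)
    then show ?thesis by (simp add: vimage_def)
  qed
  ultimately show thesis using that by blast
qed

text \<open>Each slab has Gaussian volume \<open>1 / K\<close>, so the normalizing factor of the
  truncation is exactly the \<open>K\<close> in the block mixture. The weights are uniform.\<close>

lemma block_mixture_in_Mix_P_conv:
  fixes cell :: "real ^ 'n \<Rightarrow> nat"
  assumes "equipartition std_gaussian cell K" and convex: "\<And>c. convex {x. cell x = c}"
    and "0 < m" and s: "s \<in> {..<m} \<rightarrow> {..<K}"
  shows "equipartition.block_mixture std_gaussian cell K m s \<in> Mix P_conv"
proof -
  interpret equipartition std_gaussian cell K by fact
  let ?C = "\<lambda>i. {x. cell x = s i}"
  have "{x \<in> space std_gaussian. cell x = s i} \<in> sets std_gaussian" for i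
    by measurable
  then have C[measurable]: "?C i \<in> sets lebesgue" for i by simp
  have "s i < K" if "i < m" for i using s that by auto
  then have vol: "gauss_vol (?C i) = 1 / K" if "i < m" for i
    using prob_cell[of "s i"] that by (simp add: gauss_vol_def)
  have K: "0 < K" using s \<open>0 < m\<close> by fastforce
  show ?thesis
    unfolding Mix_def mem_Collect_eq
  proof (intro conjI exI[of _ m] exI[of _ "\<lambda>_. 1 / real m"] exI[of _ "\<lambda>i. gauss_trunc (?C i)"] allI impI ballI)
    fix i assume i: "i < m"
    show "gauss_trunc (?C i) \<in> P_conv"
      unfolding P_conv_def using C[of i] convex[of "s i"] vol[OF i] K by fastforce
  next
    fix A :: "(real ^ 'n) set" assume A: "A \<in> sets lebesgue"
    have "emeasure (block_mixture m s) A
        = (\<Sum>i<m. ennreal (1 / m) * (of_nat K * emeasure std_gaussian (A \<inter> ?C i)))"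
      using emeasure_block_mixture[of A m s] A by simp
    also have "\<dots> = (\<Sum>i<m. ennreal (1 / m) * emeasure (gauss_trunc (?C i)) A)"
      using A vol by (intro sum.cong) (simp_all add: emeasure_gauss_trunc ennreal_of_nat_eq_real_of_nat)
    finally show "emeasure (block_mixture m s) A
        = (\<Sum>i<m. ennreal (1 / m) * emeasure (gauss_trunc (?C i)) A)" .
  qed (use \<open>0 < m\<close> in simp_all)
qed

section \<open>Output probabilities and the impossibility argument\<close>

text \<open>Writing the output probability as an integral of the kernel over the samples lets the
  averaging bound be applied to randomized algorithms.\<close>

lemma
  fixes D :: "(real ^ 'n) measure"
  assumes \<A>: "\<A> \<in> sample_algorithms N" and "prob_space D" "sets D = sets lebesgue"
  shows emeasure_output:
      "ennreal (output_prob N \<A> D v) = (\<integral>\<^sup>+x. emeasure (\<A> x) {v} \<partial>(\<Pi>\<^sub>M i\<in>{..<N}. D))"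
    and output_prob_add: "output_prob N \<A> D Untruncated + output_prob N \<A> D Truncated = 1"
proof -
  have "prob_space (\<Pi>\<^sub>M i\<in>{..<N}. D)" using \<open>prob_space D\<close> by (intro prob_space_PiM)
  then have P: "(\<Pi>\<^sub>M i\<in>{..<N}. D) \<in> space (prob_algebra (\<Pi>\<^sub>M i\<in>{..<N}. (lebesgue :: (real ^ 'n) measure)))"
    using assms(3) by (simp add: space_prob_algebra cong: sets_PiM_cong)
  note \<A>' = \<A>[unfolded sample_algorithms_def]
  interpret B: prob_space "(\<Pi>\<^sub>M i\<in>{..<N}. D) \<bind> \<A>"
    by (rule prob_space_bind'[OF P \<A>'])
  have sets: "sets ((\<Pi>\<^sub>M i\<in>{..<N}. D) \<bind> \<A>) = UNIV"
    using sets_bind'[OF P \<A>'] by simp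
  show "ennreal (output_prob N \<A> D v) = (\<integral>\<^sup>+x. emeasure (\<A> x) {v} \<partial>(\<Pi>\<^sub>M i\<in>{..<N}. D))"
    unfolding output_prob_def B.emeasure_eq_measure[symmetric]
    by (rule emeasure_bind_prob_algebra[OF P \<A>']) simp
  have "{Untruncated} \<union> {Truncated} = space ((\<Pi>\<^sub>M i\<in>{..<N}. D) \<bind> \<A>)"
    using sets_bind'[OF P \<A>', THEN sets_eq_imp_space_eq] by (auto intro: verdict.exhaust)
  then show "output_prob N \<A> D Untruncated + output_prob N \<A> D Truncated = 1"
    unfolding output_prob_def
    by (subst B.finite_measure_Union[symmetric]) (auto simp: sets B.prob_space)
qed

theorem theoremA1:
  fixes N :: nat and \<epsilon> :: real
  assumes "N \<ge> 1" and "0 < \<epsilon>" and "\<epsilon> < 1"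
  shows "\<not> (\<exists>\<A> :: (nat \<Rightarrow> real ^ 'n) \<Rightarrow> verdict measure.
            \<A> \<in> sample_algorithms N \<and>
            output_prob N \<A> std_gaussian Untruncated \<ge> 9 / 10 \<and>
            (\<forall>D\<in>Mix P_conv. d_TV std_gaussian D \<ge> \<epsilon> \<longrightarrow>
               output_prob N \<A> D Truncated \<ge> 9 / 10))"
proof (rule notI, elim exE conjE)
  fix \<A> :: "(nat \<Rightarrow> real ^ 'n) \<Rightarrow> verdict measure"
  assume \<A>: "\<A> \<in> sample_algorithms N"
    and accept: "output_prob N \<A> std_gaussian Untruncated \<ge> 9 / 10"
    and reject: "\<forall>D\<in>Mix P_conv. d_TV std_gaussian D \<ge> \<epsilon> \<longrightarrow>
      output_prob N \<A> D Truncated \<ge> 9 / 10"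
  \<comment> \<open>Chosen so that \<open>N * (N / m) = 1 / 2\<close>; Bernoulli's inequality then
    gives \<open>(1 - N / m) ^ N \<ge> 1 / 2\<close>.\<close>
  define m where "m = 2 * N * N"
  have m: "0 < m" "N \<le> m" using \<open>N \<ge> 1\<close> by (auto simp: m_def)
  have "1 / 2 = 1 + real N * (- (N / m))"
    using \<open>N \<ge> 1\<close> by (simp add: m_def)
  also have "\<dots> \<le> (1 + - (N / m)) ^ N"
    using m by (intro Bernoulli_inequality) (simp add: field_simps)
  finally have half: "1 / 2 \<le> (1 - N / m) ^ N" by simp
  \<comment> \<open>This makes \<open>m / K\<close> less than \<open>1 - \<epsilon>\<close>, so
    every \<open>?D s\<close> is at distance at least \<open>\<epsilon>\<close> from the
    Gaussian.\<close>
  obtain K :: nat where K: "m / (1 - \<epsilon>) < K" using reals_Archimedean2 by blast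
  moreover have "0 < m / (1 - \<epsilon>)" using m \<open>\<epsilon> < 1\<close> by simp
  ultimately have "0 < K" by (metis of_nat_0_less_iff order_less_trans)
  have \<epsilon>: "\<epsilon> \<le> 1 - real m / K"
    using K \<open>0 < K\<close> \<open>\<epsilon> < 1\<close> by (simp add: field_simps)
  obtain cell :: "real ^ 'n \<Rightarrow> nat"
    where eq: "equipartition std_gaussian cell K" and convex: "\<And>c. convex {x. cell x = c}"
    using exists_convex_equipartition[OF \<open>0 < K\<close>] by blast
  interpret equipartition std_gaussian cell K by fact
  let ?S = "{..<m} \<rightarrow>\<^sub>E {..<K}" and ?D = "block_mixture m"
  have f: "(\<lambda>x. emeasure (\<A> x) {Untruncated}) \<in> borel_measurable (\<Pi>\<^sub>M i\<in>{..<N}. std_gaussian)"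
  proof -
    have "\<A> \<in> measurable (\<Pi>\<^sub>M i\<in>{..<N}. std_gaussian) (subprob_algebra (count_space UNIV))"
      using \<A> unfolding sample_algorithms_def
      by (simp add: measurable_prob_algebraD cong: measurable_cong_sets sets_PiM_cong)
    then show ?thesis
      by (rule measurable_emeasure_kernel) simp
  qed
  have D: "prob_space (?D s)" "output_prob N \<A> (?D s) Untruncated \<le> 1 / 10" if "s \<in> ?S" for s
  proof -
    have s: "s \<in> {..<m} \<rightarrow> {..<K}" using that by auto
    show p: "prob_space (?D s)" using m(1) s by (rule prob_space_block_mixture)
    have "?D s \<in> Mix P_conv"
      using eq convex m(1) s by (rule block_mixture_in_Mix_P_conv)
    moreover have "\<epsilon> \<le> d_TV std_gaussian (?D s)"
      using d_TV_block_mixture_ge[OF m(1) s] \<epsilon> by linarith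
    ultimately have "9 / 10 \<le> output_prob N \<A> (?D s) Truncated" using reject by blast
    then show "output_prob N \<A> (?D s) Untruncated \<le> 1 / 10"
      using output_prob_add[OF \<A> p] by simp
  qed
  \<comment> \<open>Averaged over the \<open>K ^ m\<close> functions \<open>s\<close>, acceptance is
    at least \<open>1 / 2 * (9 / 10) = 9 / 20\<close>, yet each \<open>?D s\<close> is accepted with
    probability at most \<open>1 / 10\<close>.\<close>
  have "ennreal (real K ^ m * (1 / 2) * (9 / 10))
    \<le> ennreal (real K ^ m * (1 - N / m) ^ N * output_prob N \<A> std_gaussian Untruncated)"
    using half accept by (intro ennreal_leI mult_mono) auto
  also have "\<dots> = ennreal (real K ^ m * (1 - N / m) ^ N) * ennreal (output_prob N \<A> std_gaussian Untruncated)"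
    using half by (intro ennreal_mult) (auto simp: output_prob_def)
  also have "\<dots> = ennreal (real K ^ m * (1 - N / m) ^ N) *
      (\<integral>\<^sup>+x. emeasure (\<A> x) {Untruncated} \<partial>(\<Pi>\<^sub>M i\<in>{..<N}. std_gaussian))"
    by (simp add: emeasure_output[OF \<A> prob_space_std_gaussian])
  also have "\<dots> \<le> (\<Sum>s\<in>?S. \<integral>\<^sup>+x. emeasure (\<A> x) {Untruncated} \<partial>(\<Pi>\<^sub>M i\<in>{..<N}. ?D s))"
    using m f by (rule nn_integral_PiM_block_mixture_average_ge)
  also have "\<dots> = (\<Sum>s\<in>?S. ennreal (output_prob N \<A> (?D s) Untruncated))"
    using D(1) by (intro sum.cong refl emeasure_output[symmetric] \<A>) auto
  also have "\<dots> \<le> (\<Sum>s\<in>?S. ennreal (1 / 10))"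
    using D(2) by (intro sum_mono ennreal_leI)
  also have "\<dots> = ennreal (real K ^ m * (1 / 10))"
    by (simp add: card_funcsetE ennreal_of_nat_eq_real_of_nat ennreal_mult[symmetric])
  finally have "real K ^ m * (1 / 2) * (9 / 10) \<le> real K ^ m * (1 / 10)"
    by (subst (asm) ennreal_le_iff) auto
  with \<open>0 < K\<close> show False by simp
qed

end
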